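(* There exist a Hilbert space $\mathcal{H}$ and closed, proper, and convex functions $f,g:\mathcal{H}\to(-\infty,\infty]$ such that $f$ is $1$-Lipschitz and for every $\alpha>1/2$ there are a point $z^0\in\mathcal{H}$ and $\gamma>0$ such that if $(z^j)_{j\ge0}$ is generated by $z^{k+1}=(1-\lambda_k)z^k+\lambda_k\,\mathbf{refl}_{\gamma f}\circ\mathbf{refl}_{\gamma g}(z^k)$ with $\lambda_k=1/2$ for all $k\ge0$, then $$f(x_g^k)+g(x_g^k)-f(x^\ast)-g(x^\ast)=\Omega\left(\frac{1}{(k+1)^\alpha}\right).$$
   Context: $\mathbf{prox}_{\gamma f}(x):=\arg\min_{y\in\mathcal{H}}f(y)+\frac{1}{2\gamma}\|y-x\|^2$, $\mathbf{refl}_{\gamma f}:=2\mathbf{prox}_{\gamma f}-I_{\mathcal{H}}$, $x_g^k:=\mathbf{prox}_{\gamma g}(z^k)$, and $x^\ast$ is a minimizer of $f+g$ (standing assumption: $\partial f+\partial g$ has a zero). $a_k=\Omega(b_k)$ means there are $c>0$ and $K$ with $a_k\ge cb_k$ for all $k\ge K$. *)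

theory Defs
  imports "HOL-Analysis.Analysis" "HOL-Algebra.Module"
begin

text \<open>
  Existence of a Hilbert space cannot be stated with the type classes \<^class>\<open>real_inner\<close> and
  \<^class>\<open>complete_space\<close>, since types cannot be quantified. Hilbert spaces are therefore structures
  with an explicit carrier: real vector spaces are modules over the ring of reals, and an inner
  product is added as a further record field. The fields \<open>mult\<close> and \<open>one\<close> inherited from the
  record of modules are unused.
\<close>

definition real_ring :: "real ring" where
  "real_ring = \<lparr>carrier = UNIV, mult = (*), one = 1, zero = 0, add = (+)\<rparr>"

record 'b ip_space = "(real, 'b) module" +
  ip :: "'b \<Rightarrow> 'b \<Rightarrow> real"

definition ip_norm :: "('b, 'm) ip_space_scheme \<Rightarrow> 'b \<Rightarrow> real" where
  "ip_norm H x = sqrt (ip H x x)"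

text \<open>\<^locale>\<open>Metric_space\<close> demands nonnegativity and symmetry outside the carrier too, hence the
  case distinction.\<close>

definition ip_dist :: "('b, 'm) ip_space_scheme \<Rightarrow> 'b \<Rightarrow> 'b \<Rightarrow> real" where
  "ip_dist H x y = (if x \<in> carrier H \<and> y \<in> carrier H then ip_norm H (x \<ominus>\<^bsub>H\<^esub> y) else 0)"

locale real_ip_space = Module.module real_ring H for H (structure) +
  assumes ip_sym: "\<lbrakk>x \<in> carrier H; y \<in> carrier H\<rbrakk> \<Longrightarrow> ip H x y = ip H y x"
    and ip_add_left: "\<lbrakk>x \<in> carrier H; y \<in> carrier H; w \<in> carrier H\<rbrakk>
      \<Longrightarrow> ip H (x \<oplus> y) w = ip H x w + ip H y w"
    and ip_smult_left: "\<lbrakk>x \<in> carrier H; y \<in> carrier H\<rbrakk> \<Longrightarrow> ip H (c \<odot> x) y = c * ip H x y"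
    and ip_nonneg: "x \<in> carrier H \<Longrightarrow> 0 \<le> ip H x x"
    and ip_eq_zeroD: "\<lbrakk>x \<in> carrier H; ip H x x = 0\<rbrakk> \<Longrightarrow> x = \<zero>"
begin

lemma smult_closed': "x \<in> carrier H \<Longrightarrow> c \<odot> x \<in> carrier H"
  by (rule smult_closed) (auto simp: real_ring_def)

lemma ip_add_right:
  assumes "x \<in> carrier H" "y \<in> carrier H" "w \<in> carrier H"
  shows "ip H w (x \<oplus> y) = ip H w x + ip H w y"
  using assms by (metis M.add.m_closed ip_add_left ip_sym)

lemma ip_smult_right:
  assumes "x \<in> carrier H" "y \<in> carrier H"
  shows "ip H y (c \<odot> x) = c * ip H y x"
  using assms by (metis smult_closed' ip_smult_left ip_sym)

lemma ip_zero_left: "y \<in> carrier H \<Longrightarrow> ip H \<zero> y = 0"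
  using ip_add_left[of \<zero> \<zero> y] by simp

lemma ip_uminus_left:
  assumes "x \<in> carrier H" "y \<in> carrier H"
  shows "ip H (\<ominus> x) y = - ip H x y"
  using ip_add_left[of x "\<ominus> x" y] ip_zero_left[of y] assms by (simp add: M.r_neg)

lemma ip_uminus_self:
  assumes "x \<in> carrier H"
  shows "ip H (\<ominus> x) (\<ominus> x) = ip H x x"
  using assms by (metis M.add.inv_closed ip_sym ip_uminus_left minus_minus)

lemma ip_expand:
  assumes "x \<in> carrier H" "y \<in> carrier H"
  shows "ip H (x \<oplus> c \<odot> y) (x \<oplus> c \<odot> y) = ip H x x + 2 * c * ip H x y + c\<^sup>2 * ip H y y"
  using assms by (simp add: ip_add_left ip_add_right smult_closed' ip_smult_left ip_smult_right
      ip_sym[of y x] power2_eq_square algebra_simps)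

lemma Cauchy_Schwarz_ip:
  assumes "x \<in> carrier H" "y \<in> carrier H"
  shows "ip H x y \<le> ip_norm H x * ip_norm H y"
proof (cases "ip H y y = 0")
  case True
  then have "ip H x y = 0"
    using assms ip_eq_zeroD ip_zero_left ip_sym by metis
  then show ?thesis using assms by (simp add: ip_norm_def ip_nonneg)
next
  case False
  then have pos: "ip H y y > 0" using ip_nonneg[of y] assms by simp
  define c where "c = - ip H x y / ip H y y"
  have "0 \<le> ip H (x \<oplus> c \<odot> y) (x \<oplus> c \<odot> y)"
    using assms by (intro ip_nonneg M.add.m_closed smult_closed')
  then have "0 \<le> ip H x x - (ip H x y)\<^sup>2 / ip H y y"
    using assms pos by (simp add: ip_expand c_def power2_eq_square field_simps)
  then have "(ip H x y)\<^sup>2 \<le> ip H x x * ip H y y"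
    using pos by (simp add: field_simps)
  then show ?thesis
    by (simp add: ip_norm_def real_le_rsqrt flip: real_sqrt_mult)
qed

lemma ip_norm_triangle:
  assumes "x \<in> carrier H" "y \<in> carrier H"
  shows "ip_norm H (x \<oplus> y) \<le> ip_norm H x + ip_norm H y"
proof -
  have "ip H (x \<oplus> y) (x \<oplus> y) = ip H x x + 2 * ip H x y + ip H y y"
    using assms by (simp add: ip_add_left ip_add_right ip_sym[of y x])
  also have "\<dots> \<le> (ip_norm H x + ip_norm H y)\<^sup>2"
    using Cauchy_Schwarz_ip[OF assms] ip_nonneg assms
    by (simp add: power2_sum ip_norm_def)
  finally show ?thesis
    using assms unfolding ip_norm_def[of H "x \<oplus> y"]
    by (intro real_le_lsqrt) (auto simp: ip_norm_def ip_nonneg)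
qed

sublocale metric: Metric_space "carrier H" "ip_dist H"
proof
  show "0 \<le> ip_dist H x y" for x y
    by (simp add: ip_dist_def ip_norm_def ip_nonneg)
  show "ip_dist H x y = ip_dist H y x" for x y
  proof (cases "x \<in> carrier H \<and> y \<in> carrier H")
    case True
    then have "y \<ominus> x = \<ominus> (x \<ominus> y)"
      by (simp add: a_minus_def M.minus_add M.a_comm)
    then show ?thesis using True by (simp add: ip_dist_def ip_norm_def ip_uminus_self)
  qed (auto simp: ip_dist_def)
  show "ip_dist H x y = 0 \<longleftrightarrow> x = y" if "x \<in> carrier H" "y \<in> carrier H" for x y
  proof -
    have "ip H (x \<ominus> y) (x \<ominus> y) = 0 \<longleftrightarrow> x \<ominus> y = \<zero>"
      using that by (metis M.minus_closed M.zero_closed ip_eq_zeroD ip_zero_left)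
    moreover have "x \<ominus> y = \<zero> \<longleftrightarrow> x = y"
      using that by (metis M.add.inv_closed M.add.inv_inv M.minus_equality M.r_neg a_minus_def)
    ultimately show ?thesis using that by (simp add: ip_dist_def ip_norm_def)
  qed
  show "ip_dist H x z \<le> ip_dist H x y + ip_dist H y z"
    if "x \<in> carrier H" "y \<in> carrier H" "z \<in> carrier H" for x y z
  proof -
    have "x \<ominus> z = (x \<ominus> y) \<oplus> (y \<ominus> z)"
      using that by (simp add: a_minus_def M.a_assoc) (simp add: M.l_neg flip: M.a_assoc)
    then show ?thesis
      using that ip_norm_triangle[of "x \<ominus> y" "y \<ominus> z"] by (simp add: ip_dist_def)
  qed
qed

end

locale real_hilbert_space = real_ip_space +
  assumes complete: "metric.mcomplete"

text \<open>
  Functions \<open>H \<rightarrow> (-\<infinity>, \<infinity>]\<close> are represented as \<^typ>\<open>ereal\<close>-valued functions, of which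
  only the values on the carrier matter; that \<open>-\<infinity>\<close> is not attained is part of
  \<open>proper_fun\<close>.
\<close>

definition proper_fun :: "('b, 'm) ip_space_scheme \<Rightarrow> ('b \<Rightarrow> ereal) \<Rightarrow> bool" where
  "proper_fun H f \<longleftrightarrow> (\<forall>x\<in>carrier H. f x \<noteq> -\<infinity>) \<and> (\<exists>x\<in>carrier H. f x \<noteq> \<infinity>)"

definition closed_fun :: "('b, 'm) ip_space_scheme \<Rightarrow> ('b \<Rightarrow> ereal) \<Rightarrow> bool" where
  "closed_fun H f \<longleftrightarrow>
     closedin (prod_topology (Metric_space.mtopology (carrier H) (ip_dist H)) euclideanreal)
       {(x, r). x \<in> carrier H \<and> f x \<le> ereal r}"

definition convex_fun :: "('b, 'm) ip_space_scheme \<Rightarrow> ('b \<Rightarrow> ereal) \<Rightarrow> bool" where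
  "convex_fun H f \<longleftrightarrow> (\<forall>x\<in>carrier H. \<forall>y\<in>carrier H. \<forall>t\<in>{0<..<1}.
     f (((1 - t) \<odot>\<^bsub>H\<^esub> x) \<oplus>\<^bsub>H\<^esub> (t \<odot>\<^bsub>H\<^esub> y)) \<le> ereal (1 - t) * f x + ereal t * f y)"

definition lipschitz_fun :: "('b, 'm) ip_space_scheme \<Rightarrow> real \<Rightarrow> ('b \<Rightarrow> ereal) \<Rightarrow> bool" where
  "lipschitz_fun H L f \<longleftrightarrow> (\<forall>x\<in>carrier H. \<bar>f x\<bar> \<noteq> \<infinity>) \<and>
     (\<forall>x\<in>carrier H. \<forall>y\<in>carrier H. \<bar>f x - f y\<bar> \<le> ereal (L * ip_norm H (x \<ominus>\<^bsub>H\<^esub> y)))"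

definition subdifferential :: "('b, 'm) ip_space_scheme \<Rightarrow> ('b \<Rightarrow> ereal) \<Rightarrow> 'b \<Rightarrow> 'b set" where
  "subdifferential H f x =
     {u \<in> carrier H. \<forall>y\<in>carrier H. f x + ereal (ip H u (y \<ominus>\<^bsub>H\<^esub> x)) \<le> f y}"

text \<open>For closed, proper, convex \<open>f\<close> and \<open>\<gamma> > 0\<close> the minimizer is unique, so the choice made by
  \<^const>\<open>arg_min_on\<close> is immaterial.\<close>

definition prox :: "('b, 'm) ip_space_scheme \<Rightarrow> real \<Rightarrow> ('b \<Rightarrow> ereal) \<Rightarrow> 'b \<Rightarrow> 'b" where
  "prox H \<gamma> f x =
     arg_min_on (\<lambda>y. f y + ereal (1 / (2 * \<gamma>) * (ip_norm H (y \<ominus>\<^bsub>H\<^esub> x))\<^sup>2)) (carrier H)"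

definition refl_prox :: "('b, 'm) ip_space_scheme \<Rightarrow> real \<Rightarrow> ('b \<Rightarrow> ereal) \<Rightarrow> 'b \<Rightarrow> 'b" where
  "refl_prox H \<gamma> f x = (2 \<odot>\<^bsub>H\<^esub> prox H \<gamma> f x) \<ominus>\<^bsub>H\<^esub> x"

definition relaxed_PRS ::
  "('b, 'm) ip_space_scheme \<Rightarrow> real \<Rightarrow> ('b \<Rightarrow> ereal) \<Rightarrow> ('b \<Rightarrow> ereal) \<Rightarrow> (nat \<Rightarrow> real) \<Rightarrow> 'b
     \<Rightarrow> (nat \<Rightarrow> 'b) \<Rightarrow> bool" where
  "relaxed_PRS H \<gamma> f g lam z0 z \<longleftrightarrow> z 0 = z0 \<and>
     (\<forall>k. z (k + 1) = ((1 - lam k) \<odot>\<^bsub>H\<^esub> z k)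
        \<oplus>\<^bsub>H\<^esub> (lam k \<odot>\<^bsub>H\<^esub> (refl_prox H \<gamma> f \<circ> refl_prox H \<gamma> g) (z k)))"

definition is_Omega :: "(nat \<Rightarrow> ereal) \<Rightarrow> (nat \<Rightarrow> real) \<Rightarrow> bool" where
  "is_Omega a b \<longleftrightarrow> (\<exists>c>0. \<exists>K. \<forall>k\<ge>K. ereal (c * b k) \<le> a k)"

end

theory Submission
  imports Defs
begin

text \<open>
  Let \<open>g\<close> be the indicator function of a closed subspace \<open>V\<close> of \<open>\<ell>\<^sup>2\<close> and \<open>f\<close> the distance to another
  one, \<open>U\<close>. Within distance \<open>\<gamma>\<close> of \<open>U\<close>, the proximal map of \<open>f\<close> is the projection onto \<open>U\<close>. The iteration is
  nonexpansive, so for large \<open>\<gamma>\<close> it never leaves this region and is the Douglas--Rachford iteration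
  for the pair \<open>U, V\<close>. Let \<open>U\<close> and \<open>V\<close> be sums of lines meeting at angles \<open>\<theta>\<^sub>i\<close> in orthogonal planes,
  with \<open>(sin \<theta>\<^sub>i)\<^sup>2 = 1 / (i + 1)\<close>. In each plane one step is the rotation by \<open>\<theta>\<^sub>i\<close> scaled by \<open>cos \<theta>\<^sub>i\<close>. Take
  every plane twice, with starting points a quarter turn apart and of squared norm
  \<open>(i + 1) powr (- 2 * \<alpha>)\<close>, which is summable for \<open>\<alpha> > 1/2\<close>. Then \<open>(f x)\<^sup>2\<close> for the \<open>k\<close>-th point \<open>x\<close> of
  \<open>V\<close> is the sum of \<open>(i + 1) powr (- 2 * \<alpha>) * (sin \<theta>\<^sub>i)\<^sup>2 * (cos \<theta>\<^sub>i) ^ (2 * k)\<close>, and already the terms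
  with \<open>2 * k \<le> i \<le> 3 * k\<close> contribute at least a constant multiple of \<open>(k + 1) powr (- 2 * \<alpha>)\<close>.
\<close>

subsection \<open>Proximal maps of distances and indicators\<close>

context real_ip_space
begin

lemma ip_uminus_right:
  assumes "x \<in> carrier H" "y \<in> carrier H"
  shows "ip H x (\<ominus> y) = - ip H x y"
  using assms by (metis M.add.inv_closed ip_sym ip_uminus_left)

lemma ip_diff_left:
  assumes "x \<in> carrier H" "y \<in> carrier H" "w \<in> carrier H"
  shows "ip H (x \<ominus> y) w = ip H x w - ip H y w"
  using assms by (simp add: a_minus_def ip_add_left ip_uminus_left)

lemma ip_diff_right:
  assumes "x \<in> carrier H" "y \<in> carrier H" "w \<in> carrier H"
  shows "ip H w (x \<ominus> y) = ip H w x - ip H w y"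
  using assms by (simp add: a_minus_def ip_add_right ip_uminus_right)

lemma ip_norm_square: "x \<in> carrier H \<Longrightarrow> (ip_norm H x)\<^sup>2 = ip H x x"
  by (simp add: ip_norm_def ip_nonneg)

lemma ip_norm_nonneg: "x \<in> carrier H \<Longrightarrow> 0 \<le> ip_norm H x"
  by (simp add: ip_norm_def ip_nonneg)

lemma ip_norm_smult: "x \<in> carrier H \<Longrightarrow> ip_norm H (c \<odot> x) = \<bar>c\<bar> * ip_norm H x"
  by (simp add: ip_norm_def ip_smult_left ip_smult_right smult_closed' real_sqrt_mult flip: mult.assoc)

lemma minus_add_cancel: "x \<in> carrier H \<Longrightarrow> y \<in> carrier H \<Longrightarrow> (x \<ominus> y) \<oplus> y = x"
  by (simp add: a_minus_def M.a_assoc M.l_neg)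

lemma smult_zero: "c \<odot> \<zero> = \<zero>"
  by (intro ip_eq_zeroD) (simp_all add: smult_closed' ip_smult_left ip_zero_left)

lemma ip_norm_zero: "ip_norm H \<zero> = 0"
  by (simp add: ip_norm_def ip_zero_left)

lemma eq_if_ip_norm_diff:
  assumes "x \<in> carrier H" "y \<in> carrier H" "ip_norm H (x \<ominus> y) = 0"
  shows "x = y"
  using assms metric.zero[of x y] by (simp add: ip_dist_def)

lemma ip_norm_diff_commute:
  assumes "x \<in> carrier H" "y \<in> carrier H"
  shows "ip_norm H (x \<ominus> y) = ip_norm H (y \<ominus> x)"
  using assms metric.commute[of x y] by (simp add: ip_dist_def)

text \<open>The quadratic growth is that of the strongly convex objective around its minimizer.\<close>

lemma prox_eqI:
  fixes \<phi> :: "'a \<Rightarrow> ereal" and \<gamma> :: real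
  defines "F \<equiv> \<lambda>x y. \<phi> y + ereal (1 / (2 * \<gamma>) * (ip_norm H (y \<ominus> x))\<^sup>2)"
  assumes "\<gamma> > 0" "x \<in> carrier H" "p \<in> carrier H" "\<bar>\<phi> p\<bar> \<noteq> \<infinity>"
    and growth: "\<And>y. y \<in> carrier H \<Longrightarrow>
      F x p + ereal (1 / (2 * \<gamma>) * (ip_norm H (y \<ominus> p))\<^sup>2) \<le> F x y"
  shows "prox H \<gamma> \<phi> x = p"
proof -
  have fin: "\<bar>F x p\<bar> \<noteq> \<infinity>" using assms(5) by (cases "\<phi> p") (auto simp: F_def)
  have le: "F x p \<le> F x y" if "y \<in> carrier H" for y
  proof -
    have "F x p + 0 \<le> F x p + ereal (1 / (2 * \<gamma>) * (ip_norm H (y \<ominus> p))\<^sup>2)"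
      using \<open>\<gamma> > 0\<close> by (intro add_left_mono) simp
    with growth[OF that] show ?thesis by simp
  qed
  have "is_arg_min (F x) (\<lambda>y. y \<in> carrier H) p"
    using le assms by (simp add: is_arg_min_linorder)
  \<comment> \<open>\<open>prox\<close> is a choice among minimizers, so \<open>p\<close> must be
    shown to be the only one. The growth term leaves another minimizer no distance to
    \<open>p\<close>; it can be isolated because \<open>F x p\<close> is finite.\<close>
  moreover have "y = p" if "is_arg_min (F x) (\<lambda>y. y \<in> carrier H) y" for y
  proof -
    have y: "y \<in> carrier H" "F x y \<le> F x p"
      using that assms by (auto simp: is_arg_min_linorder)
    with growth[OF y(1)] have "F x p + ereal (1 / (2 * \<gamma>) * (ip_norm H (y \<ominus> p))\<^sup>2) \<le> F x p"
      by simp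
    then have "1 / (2 * \<gamma>) * (ip_norm H (y \<ominus> p))\<^sup>2 \<le> 0"
      using fin by (cases "F x p") auto
    then have "ip_norm H (y \<ominus> p) = 0"
      using \<open>\<gamma> > 0\<close> by (simp add: divide_le_0_iff)
    then show ?thesis using y assms eq_if_ip_norm_diff by blast
  qed
  ultimately show ?thesis
    unfolding prox_def arg_min_on_def arg_min_def F_def by (rule some_equality)
qed

end

text \<open>An orthogonal projection is encoded algebraically, as a linear, symmetric, idempotent
  map. The closed subspace of interest is its kernel: \<open>Q\<close> projects onto the orthogonal
  complement, so that \<open>ip_norm H (Q x)\<close> is the distance of \<open>x\<close> to the
  kernel and \<open>x \<ominus> Q x\<close> its nearest point there.\<close>

locale orthogonal_projection = real_ip_space +
  fixes Q
  assumes proj_closed: "x \<in> carrier H \<Longrightarrow> Q x \<in> carrier H"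
    and proj_add: "\<lbrakk>x \<in> carrier H; y \<in> carrier H\<rbrakk> \<Longrightarrow> Q (x \<oplus> y) = Q x \<oplus> Q y"
    and proj_smult: "x \<in> carrier H \<Longrightarrow> Q (c \<odot> x) = c \<odot> Q x"
    and proj_sym: "\<lbrakk>x \<in> carrier H; y \<in> carrier H\<rbrakk> \<Longrightarrow> ip H (Q x) y = ip H x (Q y)"
    and proj_idem: "x \<in> carrier H \<Longrightarrow> Q (Q x) = Q x"
begin

lemma proj_zero: "Q \<zero> = \<zero>"
proof -
  have "ip H (Q \<zero>) (Q \<zero>) = 0"
    by (simp add: proj_sym proj_closed ip_zero_left)
  then show ?thesis by (simp add: ip_eq_zeroD proj_closed)
qed

lemma proj_uminus: "x \<in> carrier H \<Longrightarrow> Q (\<ominus> x) = \<ominus> Q x"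
  using proj_add[of "\<ominus> x" x]
  by (metis M.add.inv_closed M.l_neg M.minus_equality proj_closed proj_zero)

lemma proj_diff: "\<lbrakk>x \<in> carrier H; y \<in> carrier H\<rbrakk> \<Longrightarrow> Q (x \<ominus> y) = Q x \<ominus> Q y"
  by (simp add: a_minus_def proj_add proj_uminus)

lemma proj_residual: "x \<in> carrier H \<Longrightarrow> Q (x \<ominus> Q x) = \<zero>"
  by (simp add: proj_diff proj_closed proj_idem) (simp add: a_minus_def M.r_neg proj_closed)

text \<open>This gives the distance its Lipschitz constant 1, and later keeps reflected points in
  the region where the proximal map of the distance is a projection.\<close>

lemma ip_norm_proj_le:
  assumes "x \<in> carrier H"
  shows "ip_norm H (Q x) \<le> ip_norm H x"
proof -
  have "(ip_norm H (Q x))\<^sup>2 = ip H x (Q x)"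
    using assms by (simp add: ip_norm_square proj_closed proj_sym proj_idem)
  also have "\<dots> \<le> ip_norm H x * ip_norm H (Q x)"
    using assms by (intro Cauchy_Schwarz_ip proj_closed)
  finally show ?thesis
    using ip_norm_nonneg[of x] ip_norm_nonneg[of "Q x"] assms proj_closed
    by (cases "ip_norm H (Q x) = 0") (auto simp: power2_eq_square)
qed

lemma abs_ip_norm_proj_diff_le:
  assumes "x \<in> carrier H" "y \<in> carrier H"
  shows "\<bar>ip_norm H (Q x) - ip_norm H (Q y)\<bar> \<le> ip_norm H (x \<ominus> y)"
proof -
  have *: "ip_norm H (Q x) - ip_norm H (Q y) \<le> ip_norm H (x \<ominus> y)"
    if "x \<in> carrier H" "y \<in> carrier H" for x y
    using ip_norm_triangle[of "Q x \<ominus> Q y" "Q y"] ip_norm_proj_le[of "x \<ominus> y"] that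
    by (simp add: minus_add_cancel proj_closed proj_diff)
  show ?thesis
    using *[OF assms] *[of y x] assms by (simp add: ip_norm_diff_commute[of y x])
qed

section \<open>Distance to the kernel and indicator of the kernel\<close>

lemma lipschitz_fun_norm_proj: "lipschitz_fun H 1 (\<lambda>x. ereal (ip_norm H (Q x)))"
  using abs_ip_norm_proj_diff_le by (simp add: lipschitz_fun_def)

lemma convex_fun_norm_proj: "convex_fun H (\<lambda>x. ereal (ip_norm H (Q x)))"
  unfolding convex_fun_def
proof (intro ballI)
  fix x y t assume *: "x \<in> carrier H" "y \<in> carrier H" "t \<in> {0<..<1::real}"
  have "ip_norm H (Q (((1 - t) \<odot> x) \<oplus> (t \<odot> y))) \<le> (1 - t) * ip_norm H (Q x) + t * ip_norm H (Q y)"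
    using * ip_norm_triangle[of "(1 - t) \<odot> Q x" "t \<odot> Q y"]
    by (simp add: proj_add proj_smult smult_closed' proj_closed ip_norm_smult)
  then show "ereal (ip_norm H (Q (((1 - t) \<odot> x) \<oplus> (t \<odot> y))))
      \<le> ereal (1 - t) * ereal (ip_norm H (Q x)) + ereal t * ereal (ip_norm H (Q y))"
    by simp
qed

lemma proper_fun_norm_proj: "proper_fun H (\<lambda>x. ereal (ip_norm H (Q x)))"
  using M.zero_closed by (auto simp: proper_fun_def)

lemma continuous_map_norm_proj:
  "continuous_map metric.mtopology euclideanreal (\<lambda>x. ip_norm H (Q x))"
proof -
  have "continuous_map metric.mtopology (Metric_space.mtopology UNIV (dist :: real \<Rightarrow> real \<Rightarrow> real))
      (\<lambda>x. ip_norm H (Q x))"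
    unfolding metric.metric_continuous_map[OF Met_TC.Metric_space_axioms]
    using abs_ip_norm_proj_diff_le by (fastforce simp: ip_dist_def dist_real_def)
  then show ?thesis by simp
qed

lemma closed_fun_norm_proj: "closed_fun H (\<lambda>x. ereal (ip_norm H (Q x)))"
proof -
  let ?X = "prod_topology metric.mtopology euclideanreal"
  have "continuous_map ?X euclideanreal (\<lambda>p. snd p - ip_norm H (Q (fst p)))"
    by (intro continuous_map_diff continuous_map_snd)
       (rule continuous_map_compose[OF continuous_map_fst continuous_map_norm_proj, unfolded o_def])
  then have "closedin ?X {p \<in> topspace ?X. snd p - ip_norm H (Q (fst p)) \<in> {0..}}"
    by (rule closedin_continuous_map_preimage) simp
  then show ?thesis by (simp add: closed_fun_def case_prod_unfold mem_Times_iff)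
qed

lemma proper_fun_indicator: "proper_fun H (\<lambda>x. if Q x = \<zero> then 0 else \<infinity>)"
  using M.zero_closed proj_zero by (auto simp: proper_fun_def)

lemma convex_fun_indicator: "convex_fun H (\<lambda>x. if Q x = \<zero> then 0 else \<infinity>)"
  unfolding convex_fun_def
proof (intro ballI)
  fix x y t assume *: "x \<in> carrier H" "y \<in> carrier H" "t \<in> {0<..<1::real}"
  have "Q (((1 - t) \<odot> x) \<oplus> (t \<odot> y)) = \<zero>" if "Q x = \<zero>" "Q y = \<zero>"
    using * that by (simp add: proj_add proj_smult smult_closed' smult_zero)
  then show "(if Q (((1 - t) \<odot> x) \<oplus> (t \<odot> y)) = \<zero> then 0 else \<infinity>)
      \<le> ereal (1 - t) * (if Q x = \<zero> then 0 else \<infinity>) + ereal t * (if Q y = \<zero> then 0 else \<infinity>)"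
    using * by auto
qed

lemma closed_fun_indicator: "closed_fun H (\<lambda>x. if Q x = \<zero> then 0 else \<infinity>)"
proof -
  have "closedin metric.mtopology {x \<in> topspace metric.mtopology. ip_norm H (Q x) \<in> {0}}"
    by (rule closedin_continuous_map_preimage[OF continuous_map_norm_proj]) simp
  moreover have "{x \<in> topspace metric.mtopology. ip_norm H (Q x) \<in> {0}} = {x \<in> carrier H. Q x = \<zero>}"
    by (auto simp: ip_norm_def ip_zero_left proj_closed ip_eq_zeroD ip_nonneg)
  ultimately have "closedin (prod_topology metric.mtopology euclideanreal)
      ({x \<in> carrier H. Q x = \<zero>} \<times> {0..})"
    by (simp add: closedin_prod_Times_iff)
  moreover have "{x \<in> carrier H. Q x = \<zero>} \<times> {0..} =
      {(x, r). x \<in> carrier H \<and> (if Q x = \<zero> then 0 else \<infinity>) \<le> ereal r}"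
    by (auto split: if_splits)
  ultimately show ?thesis by (simp add: closed_fun_def)
qed

text \<open>For \<open>y\<close> in the kernel, the growth condition is Pythagoras with equality:
  \<open>y \<ominus> x\<close> is the sum of \<open>y \<ominus> (x \<ominus> Q x)\<close>, which
  lies in the kernel, and \<open>\<ominus> Q x\<close>, which is orthogonal to it.\<close>

lemma prox_indicator:
  assumes x: "x \<in> carrier H" and "\<gamma> > 0"
  shows "prox H \<gamma> (\<lambda>x. if Q x = \<zero> then 0 else \<infinity>) x = x \<ominus> Q x"
proof (rule prox_eqI)
  note Qp = proj_residual[OF x]
  from Qp show "\<bar>if Q (x \<ominus> Q x) = \<zero> then 0 else \<infinity>\<bar> \<noteq> (\<infinity>::ereal)" by simp
  show "(if Q (x \<ominus> Q x) = \<zero> then 0 else \<infinity>) + ereal (1 / (2 * \<gamma>) * (ip_norm H (x \<ominus> Q x \<ominus> x))\<^sup>2)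
      + ereal (1 / (2 * \<gamma>) * (ip_norm H (y \<ominus> (x \<ominus> Q x)))\<^sup>2)
      \<le> (if Q y = \<zero> then 0 else \<infinity>) + ereal (1 / (2 * \<gamma>) * (ip_norm H (y \<ominus> x))\<^sup>2)"
    if y: "y \<in> carrier H" for y
  proof (cases "Q y = \<zero>")
    case True
    then have "ip H y (Q x) = 0" "ip H (Q x) y = 0"
      using x y by (metis ip_sym ip_zero_left proj_closed proj_sym)+
    moreover have "ip H x (Q x) = ip H (Q x) (Q x)" "ip H (Q x) x = ip H (Q x) (Q x)"
      using x by (metis proj_closed proj_idem proj_sym)+
    ultimately have "(ip_norm H (y \<ominus> x))\<^sup>2
        = (ip_norm H (x \<ominus> Q x \<ominus> x))\<^sup>2 + (ip_norm H (y \<ominus> (x \<ominus> Q x)))\<^sup>2"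
      using x y by (simp add: ip_norm_square proj_closed ip_diff_left ip_diff_right)
    then show ?thesis using True Qp by (simp add: algebra_simps add_divide_distrib)
  qed simp
qed (use assms in \<open>auto simp: proj_closed\<close>)

text \<open>The proximal map of a distance moves a point towards the subspace by at most \<gamma>,
  so it arrives if the distance is at most \<gamma>. In the growth condition the cross term
  \<open>ip H (Q y) (Q x)\<close> is at most \<gamma> times the distance of \<open>y\<close>, and
  division by \<gamma> turns it into the value of the function at \<open>y\<close>.\<close>

lemma prox_norm_proj:
  assumes x: "x \<in> carrier H" and "\<gamma> > 0" and small: "ip_norm H (Q x) \<le> \<gamma>"
  shows "prox H \<gamma> (\<lambda>x. ereal (ip_norm H (Q x))) x = x \<ominus> Q x"
proof (rule prox_eqI)
  note Qp = proj_residual[OF x]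
  show "ereal (ip_norm H (Q (x \<ominus> Q x))) + ereal (1 / (2 * \<gamma>) * (ip_norm H (x \<ominus> Q x \<ominus> x))\<^sup>2)
      + ereal (1 / (2 * \<gamma>) * (ip_norm H (y \<ominus> (x \<ominus> Q x)))\<^sup>2)
      \<le> ereal (ip_norm H (Q y)) + ereal (1 / (2 * \<gamma>) * (ip_norm H (y \<ominus> x))\<^sup>2)"
    if y: "y \<in> carrier H" for y
  proof -
    have "ip H y (Q x) = ip H (Q y) (Q x)" "ip H (Q x) y = ip H (Q y) (Q x)"
      using x y by (metis ip_sym proj_closed proj_idem proj_sym)+
    moreover have "ip H x (Q x) = ip H (Q x) (Q x)" "ip H (Q x) x = ip H (Q x) (Q x)"
      using x by (metis proj_closed proj_idem proj_sym)+
    ultimately have "(ip_norm H (x \<ominus> Q x \<ominus> x))\<^sup>2 + (ip_norm H (y \<ominus> (x \<ominus> Q x)))\<^sup>2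
        = (ip_norm H (y \<ominus> x))\<^sup>2 + 2 * ip H (Q y) (Q x)"
      using x y by (simp add: ip_norm_square proj_closed ip_diff_left ip_diff_right)
    also have "ip H (Q y) (Q x) \<le> ip_norm H (Q y) * ip_norm H (Q x)"
      using x y by (intro Cauchy_Schwarz_ip proj_closed)
    also have "\<dots> \<le> ip_norm H (Q y) * \<gamma>"
      using small y by (intro mult_left_mono) (auto simp: ip_norm_nonneg proj_closed)
    finally have "1 / (2 * \<gamma>) * ((ip_norm H (x \<ominus> Q x \<ominus> x))\<^sup>2 + (ip_norm H (y \<ominus> (x \<ominus> Q x)))\<^sup>2)
        \<le> 1 / (2 * \<gamma>) * ((ip_norm H (y \<ominus> x))\<^sup>2 + 2 * (ip_norm H (Q y) * \<gamma>))"
      using \<open>\<gamma> > 0\<close> by (intro mult_left_mono) auto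
    also have "\<dots> = ip_norm H (Q y) + 1 / (2 * \<gamma>) * (ip_norm H (y \<ominus> x))\<^sup>2"
      using \<open>\<gamma> > 0\<close> by (simp add: add_divide_distrib)
    finally show ?thesis using Qp by (simp add: ip_norm_zero distrib_left add_divide_distrib)
  qed
qed (use assms in \<open>auto simp: proj_closed\<close>)

end


subsection \<open>The Hilbert space \<open>\<ell>\<^sup>2\<close>\<close>

lemma cring_real_ring: "cring real_ring"
proof (rule cringI)
  show "abelian_group real_ring"
    by (rule abelian_groupI) (auto simp: real_ring_def intro: exI[of _ "- x" for x])
  show "comm_monoid real_ring"
    by (rule comm_monoidI) (auto simp: real_ring_def)
qed (auto simp: real_ring_def algebra_simps)

definition ell2 :: "('i \<Rightarrow> real) ip_space" where
  "ell2 = \<lparr>carrier = {x. (\<lambda>i. (x i)\<^sup>2) summable_on UNIV},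
     mult = (\<lambda>x y i. x i * y i), one = (\<lambda>i. 1), zero = (\<lambda>i. 0), add = (\<lambda>x y i. x i + y i),
     smult = (\<lambda>c x i. c * x i), ip = (\<lambda>x y. \<Sum>\<^sub>\<infinity>i. x i * y i)\<rparr>"

lemma ell2_simps [simp]:
  "x \<in> carrier ell2 \<longleftrightarrow> (\<lambda>i. (x i)\<^sup>2) summable_on UNIV"
  "\<zero>\<^bsub>ell2\<^esub> = (\<lambda>i. 0)" "x \<oplus>\<^bsub>ell2\<^esub> y = (\<lambda>i. x i + y i)" "c \<odot>\<^bsub>ell2\<^esub> x = (\<lambda>i. c * x i)"
  "ip ell2 x y = (\<Sum>\<^sub>\<infinity>i. x i * y i)"
  by (simp_all add: ell2_def)

lemma ell2_mult_summable:
  fixes x y :: "'i \<Rightarrow> real"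
  assumes "x \<in> carrier ell2" "y \<in> carrier ell2"
  shows "(\<lambda>i. x i * y i) summable_on UNIV"
proof -
  have "(\<lambda>i. (x i)\<^sup>2 + (y i)\<^sup>2) summable_on UNIV"
    using assms by (simp add: summable_on_add)
  then have "(\<lambda>i. norm (x i * y i)) summable_on UNIV"
  proof (rule summable_on_comparison_test)
    fix i
    have "2 * (\<bar>x i\<bar> * \<bar>y i\<bar>) \<le> (x i)\<^sup>2 + (y i)\<^sup>2"
      using sum_squares_bound[of "\<bar>x i\<bar>" "\<bar>y i\<bar>"] by simp
    moreover have "0 \<le> \<bar>x i\<bar> * \<bar>y i\<bar>" by simp
    ultimately show "norm (x i * y i) \<le> (x i)\<^sup>2 + (y i)\<^sup>2"
      unfolding real_norm_def abs_mult by linarith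
  qed auto
  then show ?thesis by (rule abs_summable_summable)
qed

lemma ell2_add_closed:
  fixes x y :: "'i \<Rightarrow> real"
  assumes "x \<in> carrier ell2" "y \<in> carrier ell2"
  shows "(\<lambda>i. x i + y i) \<in> carrier ell2"
  using assms ell2_mult_summable[OF assms]
  by (auto simp: power2_sum mult.assoc intro!: summable_on_add summable_on_cmult_right)

lemma ell2_smult_closed: "x \<in> carrier ell2 \<Longrightarrow> (\<lambda>i. c * x i) \<in> carrier ell2"
  by (simp add: power_mult_distrib summable_on_cmult_right)

lemma abelian_group_ell2: "abelian_group (ell2 :: ('i \<Rightarrow> real) ip_space)"
proof (rule abelian_groupI)
  show "\<exists>y\<in>carrier ell2. y \<oplus>\<^bsub>ell2\<^esub> x = \<zero>\<^bsub>ell2\<^esub>" if "x \<in> carrier ell2" for x :: "'i \<Rightarrow> real"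
    using that by (intro bexI[of _ "\<lambda>i. - x i"]) auto
qed (use ell2_add_closed in \<open>auto simp: algebra_simps\<close>)

lemma real_ip_space_ell2: "real_ip_space (ell2 :: ('i \<Rightarrow> real) ip_space)"
proof (intro real_ip_space.intro real_ip_space_axioms.intro)
  show "Module.module real_ring (ell2 :: ('i \<Rightarrow> real) ip_space)"
    by (rule moduleI[OF cring_real_ring abelian_group_ell2])
       (use ell2_smult_closed in \<open>auto simp: real_ring_def algebra_simps\<close>)
  fix x y w :: "'i \<Rightarrow> real" and c :: real
  assume x: "x \<in> carrier ell2"
  show "ip ell2 x x \<ge> 0" by (auto intro: infsum_nonneg)
  show "x = \<zero>\<^bsub>ell2\<^esub>" if "ip ell2 x x = 0"
  proof -
    have "x i * x i = 0" for i
      by (rule nonneg_infsum_le_0D[where A = UNIV and f = "\<lambda>i. x i * x i"])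
         (use that x ell2_mult_summable[OF x x] in auto)
    then show ?thesis by auto
  qed
  assume y: "y \<in> carrier ell2"
  show "ip ell2 x y = ip ell2 y x" by (simp add: mult.commute)
  show "ip ell2 (c \<odot>\<^bsub>ell2\<^esub> x) y = c * ip ell2 x y"
    by (simp add: mult.assoc infsum_cmult_right')
  assume w: "w \<in> carrier ell2"
  show "ip ell2 (x \<oplus>\<^bsub>ell2\<^esub> y) w = ip ell2 x w + ip ell2 y w"
    using ell2_mult_summable[OF x w] ell2_mult_summable[OF y w]
    by (simp add: distrib_right infsum_add)
qed

interpretation ell2: real_ip_space ell2
  by (rule real_ip_space_ell2)

lemma ell2_minus:
  assumes "x \<in> carrier ell2" "y \<in> carrier ell2"
  shows "x \<ominus>\<^bsub>ell2\<^esub> y = (\<lambda>i. x i - y i)"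
proof -
  have "\<ominus>\<^bsub>ell2\<^esub> y = (\<lambda>i. - y i)"
    using assms by (intro ell2.M.minus_equality) auto
  then show ?thesis by (simp add: a_minus_def)
qed

lemma ell2_minus_closed:
  assumes "x \<in> carrier ell2" "y \<in> carrier ell2"
  shows "(\<lambda>i. x i - y i) \<in> carrier ell2"
  using ell2.M.minus_closed[OF assms] by (simp only: ell2_minus[OF assms])

lemma ip_norm_ell2: "ip_norm ell2 x = sqrt (\<Sum>\<^sub>\<infinity>i. (x i)\<^sup>2)"
  by (simp add: ip_norm_def power2_eq_square)

lemma ell2_sum_le_norm:
  assumes "x \<in> carrier ell2" "finite F"
  shows "(\<Sum>i\<in>F. (x i)\<^sup>2) \<le> (ip_norm ell2 x)\<^sup>2"
proof -
  have "(\<Sum>i\<in>F. (x i)\<^sup>2) \<le> (\<Sum>\<^sub>\<infinity>i. (x i)\<^sup>2)"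
    using assms by (intro finite_sum_le_infsum) auto
  then show ?thesis by (simp add: ip_norm_ell2 infsum_nonneg)
qed

text \<open>Finite sums survive pointwise limits, which is how membership and norm bounds reach the
  limit in the completeness proof.\<close>

lemma ell2_bounded_sums:
  assumes "\<And>F. finite F \<Longrightarrow> (\<Sum>i\<in>F. (x i)\<^sup>2) \<le> b\<^sup>2" "b \<ge> 0"
  shows "x \<in> carrier ell2" "ip_norm ell2 x \<le> b"
proof -
  have "(\<lambda>i. (x i)\<^sup>2) summable_on UNIV"
    using assms by (intro nonneg_bdd_above_summable_on) (auto intro!: bdd_aboveI)
  then show "x \<in> carrier ell2" by simp
  from \<open>_ summable_on _\<close> have "(\<Sum>\<^sub>\<infinity>i. (x i)\<^sup>2) \<le> b\<^sup>2"
    using assms by (intro infsum_le_finite_sums) auto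
  then show "ip_norm ell2 x \<le> b"
    using assms(2) by (simp add: ip_norm_ell2 real_le_lsqrt)
qed

text \<open>A coordinate is bounded by the norm, so a Cauchy sequence converges coordinatewise to
  some \<open>x\<close>. Letting \<open>n\<close> tend to infinity in the finite sums for
  \<open>\<sigma> m - \<sigma> n\<close> bounds the norm of \<open>\<sigma> m - x\<close>; then
  \<open>x\<close> is a difference of two members.\<close>

lemma mcomplete_ell2: "ell2.metric.mcomplete TYPE('i)"
  unfolding ell2.metric.mcomplete_def
proof (intro allI impI)
  fix \<sigma> :: "nat \<Rightarrow> 'i \<Rightarrow> real"
  assume "ell2.metric.MCauchy \<sigma>"
  then have \<sigma>: "\<sigma> m \<in> carrier ell2"
    and Cauchy: "\<epsilon> > 0 \<Longrightarrow> \<exists>N. \<forall>m n. N \<le> m \<longrightarrow> N \<le> n \<longrightarrow> ip_dist ell2 (\<sigma> m) (\<sigma> n) < \<epsilon>" for m \<epsilon>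
    by (auto simp: ell2.metric.MCauchy_def simp del: ell2_simps)
  define \<delta> where "\<delta> m n = (\<lambda>i. \<sigma> m i - \<sigma> n i)" for m n
  have \<delta>: "\<delta> m n \<in> carrier ell2" "ip_dist ell2 (\<sigma> m) (\<sigma> n) = ip_norm ell2 (\<delta> m n)" for m n
    using \<sigma> ell2_minus[OF \<sigma> \<sigma>] ell2_minus_closed[OF \<sigma> \<sigma>]
    by (simp_all add: ip_dist_def \<delta>_def del: ell2_simps)
  have "Cauchy (\<lambda>m. \<sigma> m i)" for i
  proof (rule metric_CauchyI)
    fix \<epsilon> :: real assume "\<epsilon> > 0"
    then obtain N where N: "N \<le> m \<Longrightarrow> N \<le> n \<Longrightarrow> ip_norm ell2 (\<delta> m n) < \<epsilon>" for m n
      using Cauchy[of \<epsilon>] unfolding \<delta> by metis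
    have "dist (\<sigma> m i) (\<sigma> n i) < \<epsilon>" if "N \<le> m" "N \<le> n" for m n
    proof -
      have "(\<delta> m n i)\<^sup>2 \<le> (ip_norm ell2 (\<delta> m n))\<^sup>2"
        using ell2_sum_le_norm[OF \<delta>(1), of "{i}"] by simp
      then have "\<bar>\<delta> m n i\<bar> \<le> ip_norm ell2 (\<delta> m n)"
        using ell2.ip_norm_nonneg[OF \<delta>(1)] by (simp add: power2_le_iff_abs_le)
      with N[OF that] show ?thesis by (simp add: dist_real_def \<delta>_def)
    qed
    then show "\<exists>N. \<forall>m\<ge>N. \<forall>n\<ge>N. dist (\<sigma> m i) (\<sigma> n i) < \<epsilon>" by blast
  qed
  then obtain x where x: "(\<lambda>m. \<sigma> m i) \<longlonglongrightarrow> x i" for i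
    unfolding Cauchy_convergent_iff convergent_def by metis
  have *: "\<exists>N. \<forall>m\<ge>N. (\<lambda>i. \<sigma> m i - x i) \<in> carrier ell2 \<and> ip_norm ell2 (\<lambda>i. \<sigma> m i - x i) \<le> \<epsilon>"
    if \<epsilon>: "\<epsilon> > 0" for \<epsilon>
  proof -
    obtain N where N: "N \<le> m \<Longrightarrow> N \<le> n \<Longrightarrow> ip_norm ell2 (\<delta> m n) < \<epsilon>" for m n
      using Cauchy[OF \<epsilon>] unfolding \<delta> by metis
    have "(\<Sum>i\<in>F. (\<sigma> m i - x i)\<^sup>2) \<le> \<epsilon>\<^sup>2" if "N \<le> m" "finite F" for m F
    proof (rule tendsto_upperbound)
      show "(\<lambda>n. \<Sum>i\<in>F. (\<delta> m n i)\<^sup>2) \<longlonglongrightarrow> (\<Sum>i\<in>F. (\<sigma> m i - x i)\<^sup>2)"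
        unfolding \<delta>_def by (intro tendsto_intros x)
      show "\<forall>\<^sub>F n in sequentially. (\<Sum>i\<in>F. (\<delta> m n i)\<^sup>2) \<le> \<epsilon>\<^sup>2"
        using eventually_ge_at_top[of N]
      proof eventually_elim
        case (elim n)
        have "(ip_norm ell2 (\<delta> m n))\<^sup>2 \<le> \<epsilon>\<^sup>2"
          using N[OF \<open>N \<le> m\<close> elim] ell2.ip_norm_nonneg[OF \<delta>(1)] by (intro power_mono) auto
        with ell2_sum_le_norm[OF \<delta>(1) \<open>finite F\<close>] show ?case by (rule order_trans)
      qed
    qed simp
    then show ?thesis using ell2_bounded_sums[of _ \<epsilon>] \<epsilon> by (metis less_imp_le)
  qed
  obtain N where "(\<lambda>i. \<sigma> N i - x i) \<in> carrier ell2"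
    using *[of 1] by auto
  then have x_closed: "x \<in> carrier ell2"
    using ell2_minus_closed[OF \<sigma>[of N], of "\<lambda>i. \<sigma> N i - x i"] by (simp del: ell2_simps)
  have "limitin ell2.metric.mtopology \<sigma> x sequentially"
    unfolding ell2.metric.limitin_metric
  proof (intro conjI allI impI x_closed)
    fix \<epsilon> :: real assume "\<epsilon> > 0"
    then obtain N where N: "N \<le> m \<Longrightarrow> ip_norm ell2 (\<lambda>i. \<sigma> m i - x i) \<le> \<epsilon> / 2" for m
      using *[of "\<epsilon> / 2"] by auto
    show "\<forall>\<^sub>F m in sequentially. \<sigma> m \<in> carrier ell2 \<and> ip_dist ell2 (\<sigma> m) x < \<epsilon>"
      using eventually_ge_at_top[of N]
    proof eventually_elim
      case (elim m)
      then show ?case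
        using N[OF elim] \<sigma>[of m] x_closed ell2_minus[OF \<sigma>[of m] x_closed] \<open>\<epsilon> > 0\<close>
        by (simp add: ip_dist_def del: ell2_simps)
    qed
  qed
  then show "\<exists>x. limitin ell2.metric.mtopology \<sigma> x sequentially" by blast
qed

lemma real_hilbert_space_ell2: "real_hilbert_space (ell2 :: ('i \<Rightarrow> real) ip_space)"
  by unfold_locales (rule mcomplete_ell2)

lemma ell2_dominated:
  assumes "e \<in> carrier ell2" "\<And>i. \<bar>x i\<bar> \<le> \<bar>e i\<bar>"
  shows "x \<in> carrier ell2" "ip_norm ell2 x \<le> ip_norm ell2 e"
proof -
  have "(\<Sum>i\<in>F. (x i)\<^sup>2) \<le> (ip_norm ell2 e)\<^sup>2" if "finite F" for F
  proof -
    have "(\<Sum>i\<in>F. (x i)\<^sup>2) \<le> (\<Sum>i\<in>F. (e i)\<^sup>2)"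
      using assms(2) by (intro sum_mono) (simp add: abs_le_square_iff)
    with ell2_sum_le_norm[OF assms(1) that] show ?thesis by linarith
  qed
  then show "x \<in> carrier ell2" "ip_norm ell2 x \<le> ip_norm ell2 e"
    using ell2_bounded_sums ell2.ip_norm_nonneg[OF assms(1)] by blast+
qed

lemma ell2_reindex:
  assumes "x \<in> carrier ell2" "bij p"
  shows "(\<lambda>i. x (p i)) \<in> carrier ell2"
  using assms(1) summable_on_reindex_bij_betw[OF assms(2), of "\<lambda>i. (x i)\<^sup>2"] by simp


subsection \<open>Lines at small angles\<close>

text \<open>The coordinates \<open>4 * i, \<dots>, 4 * i + 3\<close> form the block \<open>i\<close>, a sum of two planes with coordinates
  \<open>(a, b)\<close>. In both planes the two subspaces are the line \<open>b = 0\<close> and the line at angle \<open>\<theta>\<close> to it, where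
  \<open>(sin \<theta>)\<^sup>2 = 1 / (i + 1)\<close>. The maps \<open>odd_part\<close> and \<open>line_part\<close> are the projections onto the
  orthogonal complements of these subspaces.\<close>

definition odd_part :: "(nat \<Rightarrow> real) \<Rightarrow> nat \<Rightarrow> real" where
  "odd_part x n = (if even n then 0 else x n)"

interpretation odd_part: orthogonal_projection ell2 odd_part
proof unfold_locales
  fix x y :: "nat \<Rightarrow> real" and c :: real
  show "odd_part x \<in> carrier ell2" if "x \<in> carrier ell2"
    by (rule ell2_dominated(1)[OF that]) (simp add: odd_part_def)
  show "ip ell2 (odd_part x) y = ip ell2 x (odd_part y)"
    by (auto simp: odd_part_def intro!: infsum_cong)
qed (auto simp: odd_part_def)

text \<open>The swap of the two coordinates of a plane.\<close>

definition partner :: "nat \<Rightarrow> nat" where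
  "partner n = (if even n then n + 1 else n - 1)"

lemma partner_partner [simp]: "partner (partner n) = n"
  by (auto simp: partner_def elim: oddE)

lemma bij_partner: "bij partner"
  by (rule o_bij[of partner]) auto

text \<open>The line at angle \<theta> has the unit normal
  \<open>(sin \<theta>, - cos \<theta>)\<close>. The projection onto this normal has the diagonal
  entries \<open>(sin \<theta>)\<^sup>2\<close> and \<open>(cos \<theta>)\<^sup>2\<close>, and both
  off-diagonal entries are \<open>- sin \<theta> * cos \<theta>\<close>, the negative of
  \<open>line_cross\<close>.\<close>

definition line_diag :: "nat \<Rightarrow> real" where
  "line_diag n = (if even n then 1 else real (n div 4)) / (real (n div 4) + 1)"

definition line_cross :: "nat \<Rightarrow> real" where
  "line_cross n = sqrt (real (n div 4)) / (real (n div 4) + 1)"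

definition line_part :: "(nat \<Rightarrow> real) \<Rightarrow> nat \<Rightarrow> real" where
  "line_part x n = line_diag n * x n - line_cross n * x (partner n)"

lemma partner_div: "partner n div 4 = n div 4"
proof -
  have "partner n div 2 = n div 2"
    by (cases "even n") (auto simp: partner_def elim!: evenE oddE)
  moreover have "m div 4 = m div 2 div 2" for m :: nat
    by (simp flip: div_mult2_eq)
  ultimately show ?thesis by metis
qed

lemma line_cross_partner: "line_cross (partner n) = line_cross n"
  by (simp add: line_cross_def partner_div)

lemma line_diag_partner: "line_diag n + line_diag (partner n) = 1"
  by (auto simp: line_diag_def partner_div) (auto simp: partner_def field_simps)

text \<open>The diagonal of the squared projection matrix; \<open>line_diag_partner\<close> handles
  its off-diagonal entries.\<close>

lemma line_diag_square: "(line_diag n)\<^sup>2 + (line_cross n)\<^sup>2 = line_diag n"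
proof -
  define r where "r = real (n div 4)"
  have r: "r + 1 \<noteq> 0" "(sqrt r)\<^sup>2 = r" by (simp_all add: r_def)
  have "(1 / (r + 1))\<^sup>2 + (sqrt r / (r + 1))\<^sup>2 = 1 / (r + 1)"
    unfolding power_divide r(2) using r(1) by (simp add: divide_simps power2_eq_square)
  moreover have "(r / (r + 1))\<^sup>2 + (sqrt r / (r + 1))\<^sup>2 = r / (r + 1)"
    unfolding power_divide r(2) using r(1) by (simp add: divide_simps power2_eq_square) (simp add: algebra_simps)
  ultimately show ?thesis by (simp add: line_diag_def line_cross_def r_def)
qed

lemma line_diag_bounds: "\<bar>line_diag n\<bar> \<le> 1" "\<bar>line_cross n\<bar> \<le> 1"
proof -
  have d: "0 \<le> line_diag n" "line_diag n \<le> 1"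
    by (auto simp: line_diag_def)
  then show "\<bar>line_diag n\<bar> \<le> 1" by simp
  have "(line_cross n)\<^sup>2 \<le> 1"
    using line_diag_square[of n] d zero_le_power2[of "line_diag n"] by linarith
  then show "\<bar>line_cross n\<bar> \<le> 1" by (simp add: abs_square_le_1)
qed

interpretation line_part: orthogonal_projection ell2 line_part
proof unfold_locales
  fix x y :: "nat \<Rightarrow> real" and c :: real
  have terms: "(\<lambda>n. line_diag n * x n) \<in> carrier ell2" "(\<lambda>n. line_cross n * x (partner n)) \<in> carrier ell2"
    if x: "x \<in> carrier ell2" for x
  proof -
    show "(\<lambda>n. line_diag n * x n) \<in> carrier ell2"
      by (rule ell2_dominated(1)[OF x]) (simp add: abs_mult mult_left_le_one_le line_diag_bounds)
    show "(\<lambda>n. line_cross n * x (partner n)) \<in> carrier ell2"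
      by (rule ell2_dominated(1)[OF ell2_reindex[OF x bij_partner]])
         (simp add: abs_mult mult_left_le_one_le line_diag_bounds)
  qed
  assume x: "x \<in> carrier ell2"
  show "line_part x \<in> carrier ell2"
    using ell2_minus_closed[OF terms[OF x]] unfolding line_part_def by simp
  show "line_part (line_part x) = line_part x"
  proof
    fix n
    have "line_part (line_part x) n = ((line_diag n)\<^sup>2 + (line_cross n)\<^sup>2) * x n
        - line_cross n * (line_diag n + line_diag (partner n)) * x (partner n)"
      by (simp add: line_part_def line_cross_partner power2_eq_square algebra_simps)
    then show "line_part (line_part x) n = line_part x n"
      by (simp add: line_diag_square line_diag_partner line_part_def)
  qed
  assume y: "y \<in> carrier ell2"
  have split: "line_part x = (\<lambda>n. line_diag n * x n) \<ominus>\<^bsub>ell2\<^esub> (\<lambda>n. line_cross n * x (partner n))"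
    if "x \<in> carrier ell2" for x
    using ell2_minus[OF terms[OF that]] by (simp add: line_part_def fun_eq_iff)
  \<comment> \<open>Summing over \<open>partner n\<close> in place of \<open>n\<close> moves the
    swap from \<open>x\<close> to \<open>y\<close>, as \<open>line_cross\<close> agrees on the two
    coordinates of a plane.\<close>
  have "(\<Sum>\<^sub>\<infinity>n. line_cross n * x (partner n) * y n)
      = (\<Sum>\<^sub>\<infinity>n. x n * (line_cross n * y (partner n)))"
    using infsum_reindex_bij_betw[OF bij_partner, of "\<lambda>n. line_cross n * x (partner n) * y n"]
    by (simp add: line_cross_partner mult_ac)
  moreover have "(\<Sum>\<^sub>\<infinity>n. line_diag n * x n * y n) = (\<Sum>\<^sub>\<infinity>n. x n * (line_diag n * y n))"
    by (simp add: mult_ac)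
  ultimately show "ip ell2 (line_part x) y = ip ell2 x (line_part y)"
    unfolding split[OF x] split[OF y]
      ell2.ip_diff_left[OF terms[OF x] y] ell2.ip_diff_right[OF terms[OF y] x] by simp
qed (auto simp: line_part_def algebra_simps)

section \<open>Starting point and a square-summable bound for all iterates\<close>

definition envelope :: "real \<Rightarrow> nat \<Rightarrow> real" where
  "envelope \<alpha> n = (real (n div 4) + 1) powr - \<alpha>"

text \<open>Since \<open>n + 1\<close> is at most four times \<open>n div 4 + 1\<close>, the squares
  are dominated by a multiple of the series of \<open>(n + 1) powr (- 2 * \<alpha>)\<close>, which
  converges because \<open>2 * \<alpha> > 1\<close>.\<close>

lemma envelope_ell2:
  assumes "\<alpha> > 1/2"
  shows "envelope \<alpha> \<in> carrier ell2"
proof -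
  have sq: "(envelope \<alpha> n)\<^sup>2 = (real (n div 4) + 1) powr (- 2 * \<alpha>)" for n
    by (simp add: envelope_def power2_eq_square flip: powr_add)
  have "summable (\<lambda>n. 4 powr (2 * \<alpha>) * real (Suc n) powr (- 2 * \<alpha>))"
    using assms summable_real_powr_iff[of "- 2 * \<alpha>"]
      summable_Suc_iff[of "\<lambda>n. real n powr (- 2 * \<alpha>)"]
    by (intro summable_mult) (simp del: of_nat_Suc)
  moreover have "norm ((envelope \<alpha> n)\<^sup>2) \<le> 4 powr (2 * \<alpha>) * real (Suc n) powr (- 2 * \<alpha>)" for n
  proof -
    have "Suc n \<le> 4 * (n div 4 + 1)"
      using dividend_less_times_div[of 4 n] by simp
    then have "real (Suc n) \<le> 4 * (real (n div 4) + 1)"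
      by (simp only: flip: of_nat_le_iff[where 'a = real]) simp
    then have "(4 * (real (n div 4) + 1)) powr (- 2 * \<alpha>) \<le> real (Suc n) powr (- 2 * \<alpha>)"
      using assms by (intro powr_mono2') auto
    then have le: "4 powr (2 * \<alpha>) * (4 * (real (n div 4) + 1)) powr (- 2 * \<alpha>)
        \<le> 4 powr (2 * \<alpha>) * real (Suc n) powr (- 2 * \<alpha>)"
      by (intro mult_left_mono) auto
    have "norm ((envelope \<alpha> n)\<^sup>2) = 4 powr (2 * \<alpha>) * (4 * (real (n div 4) + 1)) powr (- 2 * \<alpha>)"
      unfolding real_norm_def abs_power2 sq
      by (simp only: powr_mult mult.assoc[symmetric] powr_add[symmetric]) simp
    with le show ?thesis by (rule ord_eq_le_trans[rotated])
  qed
  ultimately have "summable (\<lambda>n. (envelope \<alpha> n)\<^sup>2)"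
    by (rule summable_comparison_test'[where N = 0])
  then have "summable (\<lambda>n. norm ((envelope \<alpha> n)\<^sup>2))"
    by (simp only: real_norm_def abs_power2)
  then show ?thesis by (simp only: ell2_simps norm_summable_imp_summable_on)
qed

text \<open>In each block, the two planes hold orbits of the same rotation that are a quarter turn apart:
  the oscillating factors \<open>cos (k * \<theta>)\<close> and \<open>sin (k * \<theta>)\<close> of the distances then disappear from the sum
  of squares.\<close>

definition quarter_turn :: "real \<Rightarrow> nat \<Rightarrow> (nat \<Rightarrow> real) \<Rightarrow> bool" where
  "quarter_turn \<alpha> k z \<longleftrightarrow> (\<forall>i. z (4 * i + 2) = - z (4 * i + 1) \<and> z (4 * i + 3) = z (4 * i) \<and>
     (z (4 * i))\<^sup>2 + (z (4 * i + 1))\<^sup>2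
       = (real i + 1) powr (- 2 * \<alpha>) * (real i / (real i + 1)) ^ k)"

text \<open>Multiples of \<open>(1, 0)\<close> and \<open>(0, 1)\<close> in the two planes of each
  block.\<close>

definition start :: "real \<Rightarrow> nat \<Rightarrow> real" where
  "start \<alpha> n = (if n mod 4 = 0 \<or> n mod 4 = 3 then envelope \<alpha> n else 0)"

lemma quarter_turn_start: "quarter_turn \<alpha> 0 (start \<alpha>)"
proof -
  have m: "(4 * i + 1) mod 4 = 1" "(4 * i + 2) mod 4 = 2" "(4 * i + 3) mod 4 = 3"
    "(4 * i + 3) div 4 = i" for i :: nat by presburger+
  show ?thesis unfolding quarter_turn_def start_def m
    by (simp add: envelope_def power2_eq_square m flip: powr_add)
qed

lemma nat_mod4_cases:
  obtains i where "n = 4 * i" | i where "n = 4 * i + 1" | i where "n = 4 * i + 2"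
    | i where "n = 4 * i + (3::nat)"
proof -
  have "n mod 4 = 0 \<or> n mod 4 = 1 \<or> n mod 4 = 2 \<or> n mod 4 = 3"
    using mod_less_divisor[of 4 n] by linarith
  moreover have "n = 4 * (n div 4) + n mod 4" by simp
  ultimately show ?thesis using that by (metis add_0_right)
qed

text \<open>The bound is independent of \<open>k\<close> and so confines the whole orbit to one
  ball. The decay factor is at most 1, and up to sign a block contains only two different
  coordinates.\<close>

lemma quarter_turn_le_envelope:
  assumes "quarter_turn \<alpha> k z"
  shows "\<bar>z n\<bar> \<le> \<bar>envelope \<alpha> n\<bar>"
proof -
  have block: "(z (4 * i))\<^sup>2 + (z (4 * i + 1))\<^sup>2 \<le> ((real i + 1) powr - \<alpha>)\<^sup>2" for i
  proof -
    have "(z (4 * i))\<^sup>2 + (z (4 * i + 1))\<^sup>2 = (real i + 1) powr (- 2 * \<alpha>) * (real i / (real i + 1)) ^ k"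
      using assms by (simp add: quarter_turn_def)
    also have "\<dots> \<le> (real i + 1) powr (- 2 * \<alpha>)"
      by (intro mult_left_le power_le_one) auto
    finally show ?thesis by (simp add: power2_eq_square flip: powr_add)
  qed
  then have le: "(z (4 * i))\<^sup>2 \<le> ((real i + 1) powr - \<alpha>)\<^sup>2"
    "(z (4 * i + 1))\<^sup>2 \<le> ((real i + 1) powr - \<alpha>)\<^sup>2" for i
    using zero_le_power2[of "z (4 * i)"] zero_le_power2[of "z (4 * i + 1)"] by (smt (verit))+
  have "Suc (4 * i) div 4 = i" "Suc (Suc (4 * i)) div 4 = i" "(4 * i + 3) div 4 = i" for i :: nat
    by presburger+
  with le assms have "(z n)\<^sup>2 \<le> (envelope \<alpha> n)\<^sup>2"
    by (cases n rule: nat_mod4_cases) (simp_all add: envelope_def quarter_turn_def)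
  then show ?thesis by (simp add: abs_le_square_iff)
qed

text \<open>In each plane, the step is the rotation by \<open>\<theta>\<close> followed by scaling with \<open>cos \<theta>\<close>.\<close>

definition dr_step :: "(nat \<Rightarrow> real) \<Rightarrow> nat \<Rightarrow> real" where
  "dr_step z n = (real (n div 4) * z n
     + (if even n then -1 else 1) * sqrt (real (n div 4)) * z (partner n)) / (real (n div 4) + 1)"

text \<open>Rotations of a plane commute with the quarter turn, and the scaling multiplies squared
  norms by \<open>(cos \<theta>)\<^sup>2\<close>, which is \<open>i / (i + 1)\<close>.\<close>

lemma quarter_turn_dr_step:
  assumes "quarter_turn \<alpha> k z"
  shows "quarter_turn \<alpha> (Suc k) (dr_step z)"
  unfolding quarter_turn_def
proof (intro allI)
  fix i
  let ?a = "z (4 * i)" and ?b = "z (4 * i + 1)"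
  have m: "(4 * i + 1) div 4 = i" "(4 * i + 2) div 4 = i" "(4 * i + 3) div 4 = i"
    "odd (4 * i + 3)" by presburger+
  have z: "z (4 * i + 2) = - ?b" "z (4 * i + 3) = ?a"
    "?a\<^sup>2 + ?b\<^sup>2 = (real i + 1) powr (- 2 * \<alpha>) * (real i / (real i + 1)) ^ k"
    using assms by (auto simp: quarter_turn_def)
  have d: "dr_step z (4 * i) = (real i * ?a - sqrt (real i) * ?b) / (real i + 1)"
    "dr_step z (4 * i + 1) = (real i * ?b + sqrt (real i) * ?a) / (real i + 1)"
    "dr_step z (4 * i + 2) = (real i * (- ?b) - sqrt (real i) * ?a) / (real i + 1)"
    "dr_step z (4 * i + 3) = (real i * ?a + sqrt (real i) * (- ?b)) / (real i + 1)"
    unfolding dr_step_def partner_def m using z(1,2) by (simp_all add: numeral_3_eq_3)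
  \<comment> \<open>Multiplicativity of the complex modulus, applied with \<open>r = i\<close> and
    \<open>s = sqrt i\<close>.\<close>
  have rot: "(r * a - s * b)\<^sup>2 + (r * b + s * a)\<^sup>2 = (r\<^sup>2 + s\<^sup>2) * (a\<^sup>2 + b\<^sup>2)" for r s a b :: real
    by (simp add: power2_eq_square algebra_simps)
  have "(dr_step z (4 * i))\<^sup>2 + (dr_step z (4 * i + 1))\<^sup>2
      = ((real i)\<^sup>2 + (sqrt (real i))\<^sup>2) * (?a\<^sup>2 + ?b\<^sup>2) / (real i + 1)\<^sup>2"
    unfolding d power_divide add_divide_distrib[symmetric] rot ..
  also have "\<dots> = (?a\<^sup>2 + ?b\<^sup>2) * (real i / (real i + 1))"
  proof -
    have "(real i)\<^sup>2 + (sqrt (real i))\<^sup>2 = (real i + 1) * real i"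
      by (simp add: power2_eq_square distrib_right)
    then show ?thesis by (simp add: power2_eq_square)
  qed
  also have "\<dots> = (real i + 1) powr (- 2 * \<alpha>) * (real i / (real i + 1)) ^ Suc k"
    unfolding z(3) by simp
  finally have sq: "(dr_step z (4 * i))\<^sup>2 + (dr_step z (4 * i + 1))\<^sup>2
      = (real i + 1) powr (- 2 * \<alpha>) * (real i / (real i + 1)) ^ Suc k" .
  have "dr_step z (4 * i + 2) = - dr_step z (4 * i + 1)" "dr_step z (4 * i + 3) = dr_step z (4 * i)"
    unfolding d by (simp_all add: field_simps)
  with sq show "dr_step z (4 * i + 2) = - dr_step z (4 * i + 1) \<and> dr_step z (4 * i + 3) = dr_step z (4 * i) \<and>
     (dr_step z (4 * i))\<^sup>2 + (dr_step z (4 * i + 1))\<^sup>2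
       = (real i + 1) powr (- 2 * \<alpha>) * (real i / (real i + 1)) ^ Suc k"
    by blast
qed

section \<open>Lower bound for the distance of the shadow points to the lines\<close>

lemma line_part_block:
  assumes "quarter_turn \<alpha> k z"
  shows "(\<Sum>n = i * 4..<i * 4 + 4. (line_part (\<lambda>n. z n - odd_part z n) n)\<^sup>2)
    = (real i + 1) powr (- 2 * \<alpha>) * (real i / (real i + 1)) ^ k / (real i + 1)"
proof -
  let ?a = "z (4 * i)" and ?b = "z (4 * i + 1)" and ?x = "\<lambda>n. z n - odd_part z n"
  have m: "(4 * i + 1) div 4 = i" "(4 * i + 2) div 4 = i" "(4 * i + 3) div 4 = i"
    "odd (4 * i + 3)" by presburger+
  have z: "z (4 * i + 2) = - ?b" "z (4 * i + 3) = ?a"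
    "?a\<^sup>2 + ?b\<^sup>2 = (real i + 1) powr (- 2 * \<alpha>) * (real i / (real i + 1)) ^ k"
    using assms by (auto simp: quarter_turn_def)
  \<comment> \<open>Dropping the odd coordinates leaves \<open>(a, 0)\<close> and
    \<open>(- b, 0)\<close> in the two planes, at squared distances
    \<open>a\<^sup>2 * (sin \<theta>)\<^sup>2\<close> and
    \<open>b\<^sup>2 * (sin \<theta>)\<^sup>2\<close>. Their sum depends only on
    \<open>a\<^sup>2 + b\<^sup>2\<close>, which is known exactly.\<close>
  have l: "line_part ?x (4 * i) = ?a / (real i + 1)"
    "line_part ?x (4 * i + 1) = - sqrt (real i) * ?a / (real i + 1)"
    "line_part ?x (4 * i + 2) = - ?b / (real i + 1)"
    "line_part ?x (4 * i + 3) = sqrt (real i) * ?b / (real i + 1)"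
    unfolding line_part_def line_diag_def line_cross_def partner_def odd_part_def m
    using z(1,2) by (simp_all add: numeral_3_eq_3)
  have set: "{i * 4..<i * 4 + 4} = {4 * i, 4 * i + 1, 4 * i + 2, 4 * i + 3}" by auto
  have "(\<Sum>n = i * 4..<i * 4 + 4. (line_part ?x n)\<^sup>2)
      = (line_part ?x (4 * i))\<^sup>2 + (line_part ?x (4 * i + 1))\<^sup>2
        + (line_part ?x (4 * i + 2))\<^sup>2 + (line_part ?x (4 * i + 3))\<^sup>2"
    unfolding set by simp
  also have "\<dots>
      = (1 + (sqrt (real i))\<^sup>2) * (?a\<^sup>2 + ?b\<^sup>2) / (real i + 1)\<^sup>2"
    unfolding l by (simp add: power_divide power_mult_distrib add_divide_distrib distrib_left distrib_right)
  also have "\<dots> = (?a\<^sup>2 + ?b\<^sup>2) / (real i + 1)"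
    by (simp add: power2_eq_square add.commute)
  finally show ?thesis unfolding z(3) .
qed

text \<open>The lower limit for \<open>i\<close> makes \<open>k / (i + 1)\<close> at most 1/2, so by
  Bernoulli the decay factor is at least 1/2; the upper limit keeps \<open>i + 1\<close> below
  \<open>3 * (k + 1)\<close>, where the negative power is still large.\<close>

lemma block_ge:
  assumes "2 * k \<le> i" "i \<le> 3 * k" "\<alpha> > 0"
  shows "(3 * (real k + 1)) powr (- 2 * \<alpha> - 1) / 2
    \<le> (real i + 1) powr (- 2 * \<alpha>) * (real i / (real i + 1)) ^ k / (real i + 1)"
proof -
  have "1 / 2 \<le> 1 + real k * (- (1 / (real i + 1)))"
    using assms by (simp add: field_simps)
  also have "\<dots> \<le> (1 + (- (1 / (real i + 1)))) ^ k"
    by (rule Bernoulli_inequality) simp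
  also have "1 + (- (1 / (real i + 1))) = real i / (real i + 1)"
    by (simp add: field_simps)
  finally have half: "1 / 2 \<le> (real i / (real i + 1)) ^ k" .
  have "(3 * (real k + 1)) powr (- 2 * \<alpha> - 1) \<le> (real i + 1) powr (- 2 * \<alpha> - 1)"
    using assms by (intro powr_mono2') auto
  then have "(3 * (real k + 1)) powr (- 2 * \<alpha> - 1) * (1 / 2)
      \<le> (real i + 1) powr (- 2 * \<alpha> - 1) * (real i / (real i + 1)) ^ k"
    using half by (intro mult_mono) auto
  also have "(real i + 1) powr (- 2 * \<alpha> - 1) = (real i + 1) powr (- 2 * \<alpha>) / (real i + 1)"
    by (simp add: powr_diff)
  finally show ?thesis by simp
qed

lemma norm_line_part_ge:
  assumes "\<alpha> > 1/2" and z: "quarter_turn \<alpha> k z"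
  shows "sqrt (3 powr (- 2 * \<alpha> - 1) / 2) * (1 / (real k + 1) powr \<alpha>)
    \<le> ip_norm ell2 (line_part (\<lambda>n. z n - odd_part z n))"
proof -
  let ?v = "line_part (\<lambda>n. z n - odd_part z n)"
  have "z \<in> carrier ell2"
    using ell2_dominated(1)[OF envelope_ell2] quarter_turn_le_envelope assms by blast
  then have v: "?v \<in> carrier ell2"
    by (intro line_part.proj_closed ell2_minus_closed odd_part.proj_closed)
  have "(real k + 1) powr (- 2 * \<alpha>) = (real k + 1) * (real k + 1) powr (- 2 * \<alpha> - 1)"
    by (simp add: powr_mult_base)
  then have "3 powr (- 2 * \<alpha> - 1) / 2 * (real k + 1) powr (- 2 * \<alpha>)
      = (real k + 1) * ((3 * (real k + 1)) powr (- 2 * \<alpha> - 1) / 2)"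
    by (simp only: powr_mult) simp
  \<comment> \<open>The range holds exactly \<open>k + 1\<close> blocks; this factor raises the
    exponent from \<open>- 2 * \<alpha> - 1\<close> to \<open>- 2 * \<alpha>\<close>.\<close>
  also have "\<dots> = (\<Sum>i = 2 * k..<3 * k + 1. (3 * (real k + 1)) powr (- 2 * \<alpha> - 1) / 2)"
    by simp
  also have "\<dots> \<le> (\<Sum>i = 2 * k..<3 * k + 1. \<Sum>n = i * 4..<i * 4 + 4. (?v n)\<^sup>2)"
    unfolding line_part_block[OF z] using assms by (intro sum_mono block_ge) auto
  \<comment> \<open>Adding the blocks below \<open>2 * k\<close> lets the blocks be joined into one
    sum over an initial segment.\<close>
  also have "\<dots> \<le> (\<Sum>i<3 * k + 1. \<Sum>n = i * 4..<i * 4 + 4. (?v n)\<^sup>2)"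
    by (intro sum_mono2) (auto intro: sum_nonneg)
  also have "\<dots> = (\<Sum>n<(3 * k + 1) * 4. (?v n)\<^sup>2)"
    by (rule sum.nat_group)
  also have "\<dots> \<le> (ip_norm ell2 ?v)\<^sup>2"
    using v by (rule ell2_sum_le_norm) simp
  also have "3 powr (- 2 * \<alpha> - 1) / 2 * (real k + 1) powr (- 2 * \<alpha>)
      = (sqrt (3 powr (- 2 * \<alpha> - 1) / 2) * (1 / (real k + 1) powr \<alpha>))\<^sup>2"
    by (simp add: power_mult_distrib power_divide powr_minus_divide power2_eq_square flip: powr_add)
  finally show ?thesis
    by (rule power2_le_imp_le) (rule ell2.ip_norm_nonneg[OF v])
qed

section \<open>The splitting iteration as a rotation with scaling\<close>

lemma relaxed_PRS_step:
  assumes z: "z \<in> carrier ell2" and "\<gamma> > 0" "ip_norm ell2 z \<le> \<gamma>"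
  defines "f \<equiv> \<lambda>x. ereal (ip_norm ell2 (line_part x))"
    and "g \<equiv> \<lambda>x. if odd_part x = \<zero>\<^bsub>ell2\<^esub> then 0 else \<infinity>"
  shows "((1 - 1/2) \<odot>\<^bsub>ell2\<^esub> z) \<oplus>\<^bsub>ell2\<^esub> ((1/2) \<odot>\<^bsub>ell2\<^esub> (refl_prox ell2 \<gamma> f \<circ> refl_prox ell2 \<gamma> g) z)
    = dr_step z"
proof -
  \<comment> \<open>The reflection of \<open>z\<close> in the lines \<open>b = 0\<close>.\<close>
  define y where "y n = (if even n then z n else - z n)" for n
  have y: "y \<in> carrier ell2" "ip_norm ell2 y \<le> ip_norm ell2 z"
    using ell2_dominated[OF z, of y] by (auto simp: y_def)
  have oz: "odd_part z \<in> carrier ell2" and ly: "line_part y \<in> carrier ell2"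
    using z y by (auto simp: odd_part.proj_closed line_part.proj_closed simp del: ell2_simps)
  have "prox ell2 \<gamma> g z = (\<lambda>n. z n - odd_part z n)"
    unfolding g_def odd_part.prox_indicator[OF z \<open>\<gamma> > 0\<close>] by (rule ell2_minus[OF z oz])
  then have "refl_prox ell2 \<gamma> g z = (\<lambda>n. 2 * (z n - odd_part z n) - z n)"
    using ell2_minus[OF ell2_smult_closed[OF ell2_minus_closed[OF z oz], of 2] z]
    by (simp add: refl_prox_def)
  also have "\<dots> = y" by (auto simp: y_def odd_part_def)
  finally have g: "refl_prox ell2 \<gamma> g z = y" .
  \<comment> \<open>Neither the reflection nor the projection increases the norm, so
    \<open>y\<close> is close enough to the subspace for \<open>prox_norm_proj\<close>.\<close>
  have "ip_norm ell2 (line_part y) \<le> \<gamma>"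
    using line_part.ip_norm_proj_le[OF y(1)] y(2) assms(3) by linarith
  then have "prox ell2 \<gamma> f y = (\<lambda>n. y n - line_part y n)"
    unfolding f_def using line_part.prox_norm_proj[OF y(1) \<open>\<gamma> > 0\<close>] ell2_minus[OF y(1) ly] by simp
  then have f: "refl_prox ell2 \<gamma> f y = (\<lambda>n. 2 * (y n - line_part y n) - y n)"
    using ell2_minus[OF ell2_smult_closed[OF ell2_minus_closed[OF y(1) ly], of 2] y(1)]
    by (simp add: refl_prox_def)
  have "(z n + (2 * (y n - line_part y n) - y n)) / 2 = dr_step z n" for n
    by (cases "even n")
       (simp_all add: y_def line_part_def line_diag_def line_cross_def dr_step_def partner_def divide_simps,
        simp_all add: algebra_simps)
  then show ?thesis by (auto simp: g f field_simps)
qed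

theorem theorem11:
  shows "\<exists>(H :: (nat \<Rightarrow> real) ip_space) (f :: (nat \<Rightarrow> real) \<Rightarrow> ereal) (g :: (nat \<Rightarrow> real) \<Rightarrow> ereal).
    real_hilbert_space H \<and>
    closed_fun H f \<and> proper_fun H f \<and> convex_fun H f \<and>
    closed_fun H g \<and> proper_fun H g \<and> convex_fun H g \<and>
    (\<exists>x\<in>carrier H. \<exists>u\<in>subdifferential H f x. \<exists>v\<in>subdifferential H g x. u \<oplus>\<^bsub>H\<^esub> v = \<zero>\<^bsub>H\<^esub>) \<and>
    lipschitz_fun H 1 f \<and>
    (\<forall>\<alpha>::real. \<alpha> > 1/2 \<longrightarrow>
      (\<exists>z0\<in>carrier H. \<exists>\<gamma>::real. \<gamma> > 0 \<and>
        (\<forall>(z :: nat \<Rightarrow> nat \<Rightarrow> real) (lam :: nat \<Rightarrow> real) (xstar :: nat \<Rightarrow> real).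
          (\<forall>k. lam k = 1/2) \<longrightarrow>
          relaxed_PRS H \<gamma> f g lam z0 z \<longrightarrow>
          is_arg_min (\<lambda>x. f x + g x) (\<lambda>x. x \<in> carrier H) xstar \<longrightarrow>
          is_Omega (\<lambda>k. f (prox H \<gamma> g (z k)) + g (prox H \<gamma> g (z k)) - f xstar - g xstar)
                   (\<lambda>k. 1 / (real k + 1) powr \<alpha>))))"
proof -
  define f where "f x = ereal (ip_norm ell2 (line_part x))" for x
  define g where "g x = (if odd_part x = \<zero>\<^bsub>ell2\<^esub> then 0 else \<infinity> :: ereal)" for x
  have nonneg: "0 \<le> f x" "0 \<le> g x" if "x \<in> carrier ell2" for x
    using that by (auto simp: f_def g_def ell2.ip_norm_nonneg line_part.proj_closed simp del: ell2_simps)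
  have fg0: "f \<zero>\<^bsub>ell2\<^esub> = 0" "g \<zero>\<^bsub>ell2\<^esub> = 0"
    by (simp_all add: f_def g_def line_part.proj_zero odd_part.proj_zero ell2.ip_norm_zero del: ell2_simps)
  \<comment> \<open>Zero is a subgradient because both functions are nonnegative and vanish at the
    origin.\<close>
  have sub: "\<zero>\<^bsub>ell2\<^esub> \<in> subdifferential ell2 f \<zero>\<^bsub>ell2\<^esub>" "\<zero>\<^bsub>ell2\<^esub> \<in> subdifferential ell2 g \<zero>\<^bsub>ell2\<^esub>"
    using nonneg by (auto simp: subdifferential_def fg0 ell2.ip_zero_left
        simp del: ell2_simps simp flip: zero_ereal_def)
  have rate: "is_Omega (\<lambda>k. f (prox ell2 \<gamma> g (z k)) + g (prox ell2 \<gamma> g (z k)) - f xstar - g xstar)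
                   (\<lambda>k. 1 / (real k + 1) powr \<alpha>)"
    if \<alpha>: "\<alpha> > 1/2" and \<gamma>: "\<gamma> = ip_norm ell2 (envelope \<alpha>) + 1" and lam: "\<forall>k. lam k = 1/2"
      and PRS: "relaxed_PRS ell2 \<gamma> f g lam (start \<alpha>) z"
      and xstar: "is_arg_min (\<lambda>x. f x + g x) (\<lambda>x. x \<in> carrier ell2) xstar"
    for \<alpha> \<gamma> lam z xstar
  proof -
    have "\<gamma> > 0" using \<gamma> ell2.ip_norm_nonneg[OF envelope_ell2[OF \<alpha>]] by linarith
    \<comment> \<open>One \<gamma> serves all iterates, as \<open>envelope\<close> bounds each of
      them; the summand 1 in \<gamma> makes it positive.\<close>
    have bnd: "x \<in> carrier ell2 \<and> ip_norm ell2 x \<le> \<gamma>" if "quarter_turn \<alpha> k x" for x k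
      using ell2_dominated[OF envelope_ell2[OF \<alpha>] quarter_turn_le_envelope[OF that]] \<gamma> by auto
    have qt: "quarter_turn \<alpha> k (z k)" for k
    proof (induction k)
      case 0
      then show ?case using PRS quarter_turn_start by (simp add: relaxed_PRS_def)
    next
      case (Suc k)
      have "z (Suc k) = dr_step (z k)"
        using PRS lam relaxed_PRS_step[of "z k" \<gamma>] bnd[OF Suc.IH] \<open>\<gamma> > 0\<close>
        unfolding relaxed_PRS_def f_def g_def by (simp del: ell2_simps)
      with quarter_turn_dr_step[OF Suc.IH] show ?case by simp
    qed
    \<comment> \<open>The origin gives the sum the value 0, so at a minimizer both nonnegative terms
      vanish.\<close>
    have "xstar \<in> carrier ell2" "f xstar + g xstar \<le> 0"
      using xstar ell2.M.zero_closed fg0 unfolding is_arg_min_linorder by (metis add_0)+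
    then have star: "f xstar = 0" "g xstar = 0"
      using nonneg by (metis add_nonneg_eq_0_iff add_nonneg_nonneg order_antisym)+
    have "ereal (sqrt (3 powr (- 2 * \<alpha> - 1) / 2) * (1 / (real k + 1) powr \<alpha>))
        \<le> f (prox ell2 \<gamma> g (z k)) + g (prox ell2 \<gamma> g (z k)) - f xstar - g xstar" for k
    proof -
      have zk: "z k \<in> carrier ell2" using bnd[OF qt] by blast
      have p: "prox ell2 \<gamma> g (z k) = z k \<ominus>\<^bsub>ell2\<^esub> odd_part (z k)"
        unfolding g_def by (rule odd_part.prox_indicator[OF zk \<open>\<gamma> > 0\<close>])
      then have "g (prox ell2 \<gamma> g (z k)) = 0"
        using odd_part.proj_residual[OF zk] by (simp add: g_def)
      moreover have "prox ell2 \<gamma> g (z k) = (\<lambda>n. z k n - odd_part (z k) n)"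
        unfolding p using zk by (intro ell2_minus odd_part.proj_closed)
      ultimately show ?thesis
        unfolding star using norm_line_part_ge[OF \<alpha> qt] by (simp add: f_def del: ell2_simps)
    qed
    then show ?thesis
      unfolding is_Omega_def by (intro exI[of _ "sqrt (3 powr (- 2 * \<alpha> - 1) / 2)"] conjI exI[of _ 0]) auto
  qed
  have f_eq: "f = (\<lambda>x. ereal (ip_norm ell2 (line_part x)))"
    and g_eq: "g = (\<lambda>x. if odd_part x = \<zero>\<^bsub>ell2\<^esub> then 0 else \<infinity>)"
    by (auto simp: f_def g_def)
  show ?thesis
  proof (rule exI[of _ ell2], rule exI[of _ f], rule exI[of _ g], intro conjI allI impI)
    show "real_hilbert_space (ell2 :: (nat \<Rightarrow> real) ip_space)"
      by (rule real_hilbert_space_ell2)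
    show "closed_fun ell2 f" "proper_fun ell2 f" "convex_fun ell2 f" "lipschitz_fun ell2 1 f"
      unfolding f_eq
      by (rule line_part.closed_fun_norm_proj line_part.proper_fun_norm_proj
          line_part.convex_fun_norm_proj line_part.lipschitz_fun_norm_proj)+
    show "closed_fun ell2 g" "proper_fun ell2 g" "convex_fun ell2 g"
      unfolding g_eq
      by (rule odd_part.closed_fun_indicator odd_part.proper_fun_indicator
          odd_part.convex_fun_indicator)+
    show "\<exists>x\<in>carrier ell2. \<exists>u\<in>subdifferential ell2 f x. \<exists>v\<in>subdifferential ell2 g x.
        u \<oplus>\<^bsub>ell2\<^esub> v = \<zero>\<^bsub>ell2\<^esub>"
      using sub ell2.M.l_zero[OF ell2.M.zero_closed] ell2.M.zero_closed by blast
  next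
    fix \<alpha> :: real assume \<alpha>: "\<alpha> > 1/2"
    show "\<exists>z0\<in>carrier ell2. \<exists>\<gamma>::real. \<gamma> > 0 \<and>
        (\<forall>(z :: nat \<Rightarrow> nat \<Rightarrow> real) (lam :: nat \<Rightarrow> real) (xstar :: nat \<Rightarrow> real).
          (\<forall>k. lam k = 1/2) \<longrightarrow> relaxed_PRS ell2 \<gamma> f g lam z0 z \<longrightarrow>
          is_arg_min (\<lambda>x. f x + g x) (\<lambda>x. x \<in> carrier ell2) xstar \<longrightarrow>
          is_Omega (\<lambda>k. f (prox ell2 \<gamma> g (z k)) + g (prox ell2 \<gamma> g (z k)) - f xstar - g xstar)
                   (\<lambda>k. 1 / (real k + 1) powr \<alpha>))"
    proof (intro bexI[of _ "start \<alpha>"] exI[of _ "ip_norm ell2 (envelope \<alpha>) + 1"] conjI allI impI)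
      show "start \<alpha> \<in> carrier ell2"
        using envelope_ell2[OF \<alpha>] by (rule ell2_dominated) (simp add: start_def)
      show "ip_norm ell2 (envelope \<alpha>) + 1 > 0"
        using ell2.ip_norm_nonneg[OF envelope_ell2[OF \<alpha>]] by linarith
    qed (rule rate[OF \<alpha> refl])
  qed
qed

end
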